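(* Let $C\subset\mathbb{R}^n$ be nonempty, closed and convex and let $D=\{x\in\mathbb{R}^n: Ax=b\}$ be a nonempty affine set, where $A$ is a linear operator. Suppose that $\alpha_1\in(0,2]$ and $\alpha_2\in(0,2]$. Then the GAP envelope $F=F_{\alpha_1,\alpha_2}^{\mathrm{GAP}}$ (defined in the context) satisfies, for all $x,y\in\mathbb{R}^n$, $$\tfrac{\beta_l}2\|x-y\|^2\le F(x)-F(y)-\langle\nabla F(y),x-y\rangle\le\tfrac{\beta_u}2\|x-y\|^2,$$ where $\beta_l=\min\big((1-\alpha_1)\alpha_1,0\big)$ and $\beta_u=\max\big((1-\alpha_1)(1+(\alpha_2-1)(1-\alpha_1)),\alpha_2\big)$. If in addition $\alpha_1\in(0,1]$, then $F$ is convex.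
   Context: $\langle\cdot,\cdot\rangle$ is an inner product on $\mathbb{R}^n$ with induced norm $\|\cdot\|$; $\Pi_C$ is the projection onto a nonempty closed convex set $C$ and $\iota_C$ its indicator function. Put $r_C(x)=\iota_C(x)+\tfrac12\|x\|^2$, with conjugate $r_C^*(y)=\sup_x\{\langle y,x\rangle-r_C(x)\}$, for which $\nabla r_C^*=\Pi_C$. Define $p_C^\alpha(x)=\alpha r_C^*(x)+\tfrac{1-\alpha}2\|x\|^2$ and the relaxed projection $P_C^\alpha(x)=\nabla p_C^\alpha(x)=\alpha\Pi_C(x)+(1-\alpha)x$. For the affine set $D=\{x:Ax=b\}$ let $N=\Pi_{D_0}$ with $D_0=\{x:Ax=0\}$, and let $P=(1-\alpha_1)\mathrm{Id}+\alpha_1N$ (the linear part of the affine map $P_D^{\alpha_1}$). The GAP (generalized alternating projections) envelope is $$F_{\alpha_1,\alpha_2}^{\mathrm{GAP}}(x)=\tfrac12\langle Px,x\rangle-p_C^{\alpha_2}(P_D^{\alpha_1}x).$$ *)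

theory Defs
  imports "HOL-Analysis.Analysis"
begin

(* Convex-analysis indicator, with values in {0, \<infinity>}. *)
definition convex_indicator :: "'a set \<Rightarrow> 'a \<Rightarrow> ereal" where
  "convex_indicator C x = (if x \<in> C then 0 else \<infinity>)"

definition conjugate :: "('a::real_inner \<Rightarrow> ereal) \<Rightarrow> 'a \<Rightarrow> ereal" where
  "conjugate f y = (SUP x. ereal (y \<bullet> x) - f x)"

definition r_fun :: "'a::real_inner set \<Rightarrow> 'a \<Rightarrow> ereal" where
  "r_fun C x = convex_indicator C x + ereal (1 / 2 * (norm x)\<^sup>2)"

lemma conjugate_r_fun_le:
  fixes C :: "'a::real_inner set"
  shows "conjugate (r_fun C) y \<le> ereal (1 / 2 * (norm y)\<^sup>2)"
  unfolding conjugate_def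
proof (rule SUP_least)
  fix x :: 'a
  have "0 \<le> (norm (y - x))\<^sup>2" by simp
  also have "\<dots> = (norm y)\<^sup>2 - 2 * (y \<bullet> x) + (norm x)\<^sup>2"
    by (simp add: power2_norm_eq_inner inner_diff_left inner_diff_right inner_commute)
  finally show "ereal (y \<bullet> x) - r_fun C x \<le> ereal (1 / 2 * (norm y)\<^sup>2)"
    by (simp add: r_fun_def convex_indicator_def)
qed

(* The conjugate is finite for nonempty C, so passing to the reals in p_fun loses nothing. *)
lemma conjugate_r_fun_finite:
  fixes C :: "'a::real_inner set"
  assumes "C \<noteq> {}"
  shows "\<bar>conjugate (r_fun C) y\<bar> \<noteq> \<infinity>"
proof -
  obtain c where c: "c \<in> C" using assms by blast
  have "ereal (y \<bullet> c) - r_fun C c \<le> conjugate (r_fun C) y"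
    unfolding conjugate_def by (rule SUP_upper) simp
  then have "ereal (y \<bullet> c - 1 / 2 * (norm c)\<^sup>2) \<le> conjugate (r_fun C) y"
    using c by (simp add: r_fun_def convex_indicator_def)
  then show ?thesis
    using conjugate_r_fun_le[of C y] by (cases "conjugate (r_fun C) y") auto
qed

definition p_fun :: "real \<Rightarrow> 'a::real_inner set \<Rightarrow> 'a \<Rightarrow> real" where
  "p_fun \<alpha> C x = \<alpha> * real_of_ereal (conjugate (r_fun C) x) + (1 - \<alpha>) / 2 * (norm x)\<^sup>2"

definition relaxed_proj :: "real \<Rightarrow> 'a::euclidean_space set \<Rightarrow> 'a \<Rightarrow> 'a" where
  "relaxed_proj \<alpha> C x = \<alpha> *\<^sub>R closest_point C x + (1 - \<alpha>) *\<^sub>R x"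

definition affine_set :: "('a \<Rightarrow> 'b) \<Rightarrow> 'b \<Rightarrow> 'a set" where
  "affine_set A b = {x. A x = b}"

definition P_lin :: "real \<Rightarrow> ('a::euclidean_space \<Rightarrow> 'b::euclidean_space) \<Rightarrow> 'a \<Rightarrow> 'a" where
  "P_lin \<alpha> A x = (1 - \<alpha>) *\<^sub>R x + \<alpha> *\<^sub>R closest_point (affine_set A 0) x"

definition gap_envelope ::
  "real \<Rightarrow> real \<Rightarrow> 'a::euclidean_space set \<Rightarrow> ('a \<Rightarrow> 'b::euclidean_space) \<Rightarrow> 'b \<Rightarrow> 'a \<Rightarrow> real" where
  "gap_envelope \<alpha>1 \<alpha>2 C A b x =
     1 / 2 * (P_lin \<alpha>1 A x \<bullet> x) - p_fun \<alpha>2 C (relaxed_proj \<alpha>1 (affine_set A b) x)"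

(* Meaningful only at points of differentiability. *)
definition gradient :: "('a::real_inner \<Rightarrow> real) \<Rightarrow> 'a \<Rightarrow> 'a" where
  "gradient f x = (THE g. GDERIV f x :> g)"

lemma gradient_eqI:
  assumes "GDERIV f x :> g"
  shows "gradient f x = g"
  unfolding gradient_def
proof (rule the_equality[where P = "\<lambda>g. GDERIV f x :> g", OF assms])
  fix g' assume "GDERIV f x :> g'"
  then have "(\<lambda>h. h \<bullet> g') = (\<lambda>h. h \<bullet> g)"
    using assms has_derivative_unique unfolding gderiv_def by blast
  then have "h \<bullet> (g' - g) = 0" for h
    by (metis inner_diff_right right_minus_eq)
  then show "g' = g"
    by (metis inner_eq_zero_iff right_minus_eq)
qed

end

theory Submission
  imports Defs
begin

text \<open>
  Write \<open>T = P\<^sub>D\<close> for the relaxed projection onto \<open>D\<close>, so that \<open>T x - T y = P (x - y)\<close> with \<open>P\<close>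
  symmetric. The Bregman distance of \<open>F\<close> at \<open>(x, y)\<close> is then
  \<open>(P h \<bullet> h) / 2\<close> minus the Bregman distance of \<open>p\<^sub>C\<close> at \<open>(T x, T y)\<close>, where \<open>h = x - y\<close>.
  The latter lies between \<open>(1 - \<alpha>2) / 2\<close> and \<open>1 / 2\<close> times the squared norm of \<open>P h\<close>.
  Splitting \<open>h\<close> into its components along the kernel of \<open>A\<close> and orthogonal to it
  diagonalises both quadratic forms and yields the two constants.
  Differentiability comes for free, because a function whose deviation from an affine function
  at a point is quadratically small is differentiable there.
\<close>

section \<open>Differentiability and convexity from bounds on the Bregman distance\<close>

lemma gderiv_of_quadratic_bound:
  fixes f :: "'a::real_inner \<Rightarrow> real"
  assumes "\<And>x. \<bar>f x - f y - g \<bullet> (x - y)\<bar> \<le> K * (norm (x - y))\<^sup>2"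
  shows "GDERIV f y :> g"
  unfolding gderiv_def has_derivative_at_within
proof (intro conjI)
  show "bounded_linear (\<lambda>h. h \<bullet> g)"
    by (rule bounded_linear_inner_left)
  have lim: "((\<lambda>x. K * norm (x - y)) \<longlongrightarrow> 0) (at y)"
    by (auto intro!: tendsto_eq_intros)
  have le: "norm ((f x - f y - (x - y) \<bullet> g) /\<^sub>R norm (x - y)) \<le> K * norm (x - y)" if "x \<noteq> y" for x
    using assms[of x] that
    by (simp add: inner_commute divide_simps power2_eq_square mult.assoc abs_mult)
  show "((\<lambda>x. (f x - f y - (x - y) \<bullet> g) /\<^sub>R norm (x - y)) \<longlongrightarrow> 0) (at y)"
    by (rule Lim_null_comparison[OF _ lim])
      (use le in \<open>auto simp: eventually_at_filter\<close>)
qed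

text \<open>At the convex combination z, the weighted sum of the affine minorants through z is
  \<open>f z\<close>: the linear terms cancel.\<close>

lemma convex_on_of_subgradients:
  fixes f :: "'a::real_inner \<Rightarrow> real"
  assumes sub: "\<And>x y. f y + g y \<bullet> (x - y) \<le> f x"
  shows "convex_on UNIV f"
proof (rule convex_onI)
  fix t :: real and x y :: 'a
  assume t: "0 < t" "t < 1"
  define z where "z = (1 - t) *\<^sub>R x + t *\<^sub>R y"
  have "(1 - t) * (f z + g z \<bullet> (x - z)) + t * (f z + g z \<bullet> (y - z)) \<le> (1 - t) * f x + t * f y"
    using t sub[of z x] sub[of z y] by (intro add_mono mult_left_mono) auto
  moreover have "(1 - t) * (g z \<bullet> (x - z)) + t * (g z \<bullet> (y - z)) = 0"
    by (simp add: z_def inner_simps algebra_simps)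
  ultimately show "f ((1 - t) *\<^sub>R x + t *\<^sub>R y) \<le> (1 - t) * f x + t * f y"
    unfolding z_def[symmetric] by (simp add: algebra_simps)
qed auto

section \<open>Bregman distances of the conjugate and of \<open>p_fun\<close>\<close>

lemma conjugate_r_fun_eq:
  fixes C :: "'a::euclidean_space set"
  assumes "closed C" "C \<noteq> {}"
  shows "conjugate (r_fun C) z
    = ereal (z \<bullet> closest_point C z - 1 / 2 * (norm (closest_point C z))\<^sup>2)"
  unfolding conjugate_def
proof (rule antisym)
  show "(SUP x. ereal (z \<bullet> x) - r_fun C x)
      \<le> ereal (z \<bullet> closest_point C z - 1 / 2 * (norm (closest_point C z))\<^sup>2)"
  proof (rule SUP_least)
    fix x
    show "ereal (z \<bullet> x) - r_fun C x
        \<le> ereal (z \<bullet> closest_point C z - 1 / 2 * (norm (closest_point C z))\<^sup>2)"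
    proof (cases "x \<in> C")
      case True
      \<comment> \<open>As \<open>z \<bullet> x - 1/2 |x|^2 = 1/2 |z|^2 - 1/2 |z - x|^2\<close>,
        maximising over C means minimising the distance to z.\<close>
      then have "(norm (z - closest_point C z))\<^sup>2 \<le> (norm (z - x))\<^sup>2"
        using closest_point_le[OF assms(1), of x z] by (simp add: dist_norm power_mono)
      with True show ?thesis
        by (simp add: r_fun_def convex_indicator_def power2_norm_eq_inner inner_simps inner_commute)
    qed (simp add: r_fun_def convex_indicator_def)
  qed
  have "ereal (z \<bullet> closest_point C z) - r_fun C (closest_point C z)
      \<le> (SUP x. ereal (z \<bullet> x) - r_fun C x)"
    by (rule SUP_upper) simp
  then show "ereal (z \<bullet> closest_point C z - 1 / 2 * (norm (closest_point C z))\<^sup>2)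
      \<le> (SUP x. ereal (z \<bullet> x) - r_fun C x)"
    using closest_point_in_set[OF assms] by (simp add: r_fun_def convex_indicator_def)
qed

lemma conjugate_r_fun_bregman:
  fixes C :: "'a::euclidean_space set" and u v :: 'a
  assumes "closed C" "convex C" "C \<noteq> {}"
  defines "r \<equiv> \<lambda>z. real_of_ereal (conjugate (r_fun C) z)"
  shows "0 \<le> r u - r v - closest_point C v \<bullet> (u - v)"
    and "r u - r v - closest_point C v \<bullet> (u - v) \<le> 1 / 2 * (norm (u - v))\<^sup>2"
proof -
  define a where "a = closest_point C u"
  define c where "c = closest_point C v"
  have aC: "a \<in> C" and cC: "c \<in> C"
    unfolding a_def c_def using assms closest_point_in_set by auto
  have r: "r u = u \<bullet> a - 1 / 2 * (norm a)\<^sup>2" "r v = v \<bullet> c - 1 / 2 * (norm c)\<^sup>2"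
    by (simp_all add: r_def conjugate_r_fun_eq[OF assms(1,3)] a_def c_def)
  \<comment> \<open>c competes with a in the maximisation that defines \<open>r u\<close>.\<close>
  have "(norm (u - a))\<^sup>2 \<le> (norm (u - c))\<^sup>2"
    using closest_point_le[OF assms(1) cC, of u] by (simp add: dist_norm a_def power_mono)
  then show "0 \<le> r u - r v - closest_point C v \<bullet> (u - v)"
    unfolding r c_def[symmetric]
    by (simp add: power2_norm_eq_inner inner_simps inner_commute)
  \<comment> \<open>The Bregman distance equals \<open>(v - c) \<bullet> (a - c) + (u - v) \<bullet>
    (a - c) - 1/2 |a - c|^2\<close>; the first term is nonpositive and a square bounds the
    rest.\<close>
  have "(v - c) \<bullet> (a - c) \<le> 0"
    unfolding c_def by (rule closest_point_dot[OF assms(2,1) aC])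
  moreover have "0 \<le> (norm ((u - v) - (a - c)))\<^sup>2"
    by simp
  ultimately show "r u - r v - closest_point C v \<bullet> (u - v) \<le> 1 / 2 * (norm (u - v))\<^sup>2"
    unfolding r c_def[symmetric]
    by (simp add: power2_norm_eq_inner inner_simps inner_commute)
qed

text \<open>The Bregman distance is \<open>\<alpha> * B + (1 - \<alpha>)/2 |u - v|^2\<close> with B
  that of the conjugate, between 0 and \<open>1/2 |u - v|^2\<close>; \<alpha> cancels at the upper
  end.\<close>

lemma p_fun_bregman:
  fixes C :: "'a::euclidean_space set" and u v :: 'a
  assumes "closed C" "convex C" "C \<noteq> {}" "0 \<le> \<alpha>"
  shows "(1 - \<alpha>) / 2 * (norm (u - v))\<^sup>2
      \<le> p_fun \<alpha> C u - p_fun \<alpha> C v - relaxed_proj \<alpha> C v \<bullet> (u - v)" (is "_ \<le> ?D")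
    and "p_fun \<alpha> C u - p_fun \<alpha> C v - relaxed_proj \<alpha> C v \<bullet> (u - v) \<le> 1 / 2 * (norm (u - v))\<^sup>2"
proof -
  define B where "B = real_of_ereal (conjugate (r_fun C) u) - real_of_ereal (conjugate (r_fun C) v)
    - closest_point C v \<bullet> (u - v)"
  have "(norm u)\<^sup>2 - (norm v)\<^sup>2 - 2 * (v \<bullet> (u - v)) = (norm (u - v))\<^sup>2"
    by (simp add: power2_norm_eq_inner inner_simps inner_commute)
  moreover have "?D = \<alpha> * B + (1 - \<alpha>) / 2 * ((norm u)\<^sup>2 - (norm v)\<^sup>2 - 2 * (v \<bullet> (u - v)))"
    by (simp add: p_fun_def relaxed_proj_def B_def inner_add_left) (simp add: field_simps)
  ultimately have D: "?D = \<alpha> * B + (1 - \<alpha>) / 2 * (norm (u - v))\<^sup>2"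
    by simp
  have "0 \<le> \<alpha> * B" "\<alpha> * B \<le> \<alpha> * (1 / 2 * (norm (u - v))\<^sup>2)"
    using conjugate_r_fun_bregman[OF assms(1-3), where u = u and v = v, folded B_def] assms(4)
    by (intro mult_left_mono mult_nonneg_nonneg; simp)+
  then show "(1 - \<alpha>) / 2 * (norm (u - v))\<^sup>2 \<le> ?D" "?D \<le> 1 / 2 * (norm (u - v))\<^sup>2"
    unfolding D by (auto simp: field_simps)
qed

section \<open>Projections onto affine sets and the linear part \<open>P_lin\<close>\<close>

context
  fixes A :: "'a::euclidean_space \<Rightarrow> 'b::euclidean_space"
  assumes lin: "linear A"
begin

lemma closed_affine_set: "closed (affine_set A b)"
proof -
  have "affine_set A b = A -` {b}"
    by (auto simp: affine_set_def)
  then show ?thesis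
    using lin by (simp add: closed_vimage linear_continuous_on linear_conv_bounded_linear)
qed

lemma convex_affine_set: "convex (affine_set A b)"
  using lin unfolding convex_def affine_set_def
  by (simp add: linear_add linear_scale flip: scaleR_add_left)

lemma closest_point_affine_set:
  assumes "affine_set A b \<noteq> {}"
  shows "A (closest_point (affine_set A b) x) = b"
    and "A z = 0 \<Longrightarrow> (x - closest_point (affine_set A b) x) \<bullet> z = 0"
proof -
  let ?p = "closest_point (affine_set A b) x"
  show p: "A ?p = b"
    using closest_point_in_set[OF closed_affine_set assms, of x] by (simp add: affine_set_def)
  assume z: "A z = 0"
  \<comment> \<open>Stepping in both directions along the kernel turns the variational inequality
    into an equality.\<close>
  have "?p + z \<in> affine_set A b" "?p - z \<in> affine_set A b"
    using lin p z by (auto simp: affine_set_def linear_add linear_diff)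
  from this[THEN closest_point_dot[OF convex_affine_set closed_affine_set], of x]
  show "(x - ?p) \<bullet> z = 0"
    by simp
qed

text \<open>The difference of p and the projection lies in the kernel and is the difference of two
  residuals orthogonal to the kernel, hence orthogonal to itself.\<close>

lemma closest_point_affine_set_eqI:
  assumes p: "A p = b" and orth: "\<And>z. A z = 0 \<Longrightarrow> (x - p) \<bullet> z = 0"
  shows "closest_point (affine_set A b) x = p"
proof -
  have ne: "affine_set A b \<noteq> {}"
    using p by (auto simp: affine_set_def)
  let ?q = "closest_point (affine_set A b) x"
  have k: "A (?q - p) = 0"
    using lin p closest_point_affine_set(1)[OF ne] by (simp add: linear_diff)
  have "(?q - p) \<bullet> (?q - p) = (x - p) \<bullet> (?q - p) - (x - ?q) \<bullet> (?q - p)"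
    by (simp add: inner_simps)
  also have "\<dots> = 0"
    using orth[OF k] closest_point_affine_set(2)[OF ne k] by simp
  finally show ?thesis
    by simp
qed

lemma affine_set_zero_nonempty: "affine_set A 0 \<noteq> {}"
  using linear_0[OF lin] by (auto simp: affine_set_def)

lemmas kernel_proj = closest_point_affine_set[OF affine_set_zero_nonempty]

text \<open>Differences of points of the affine set lie in the kernel, and differences of residuals
  stay orthogonal to it. The case \<open>b = 0\<close> gives additivity of the kernel
  projection.\<close>

lemma closest_point_affine_set_diff:
  assumes "affine_set A b \<noteq> {}"
  shows "closest_point (affine_set A b) x - closest_point (affine_set A b) y
    = closest_point (affine_set A 0) (x - y)"
proof (rule closest_point_affine_set_eqI[symmetric])
  show "A (closest_point (affine_set A b) x - closest_point (affine_set A b) y) = 0"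
    using lin closest_point_affine_set(1)[OF assms] by (simp add: linear_diff)
  fix z assume "A z = 0"
  from closest_point_affine_set(2)[OF assms this, of x] closest_point_affine_set(2)[OF assms this, of y]
  show "(x - y - (closest_point (affine_set A b) x - closest_point (affine_set A b) y)) \<bullet> z = 0"
    by (simp add: inner_simps)
qed

lemma relaxed_proj_affine_set_diff:
  assumes "affine_set A b \<noteq> {}"
  shows "relaxed_proj \<alpha> (affine_set A b) x - relaxed_proj \<alpha> (affine_set A b) y = P_lin \<alpha> A (x - y)"
  unfolding relaxed_proj_def P_lin_def closest_point_affine_set_diff[OF assms, symmetric]
  by (simp add: algebra_simps)

lemma P_lin_diff: "P_lin \<alpha> A (x - y) = P_lin \<alpha> A x - P_lin \<alpha> A y"
  unfolding P_lin_def closest_point_affine_set_diff[OF affine_set_zero_nonempty, symmetric]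
  by (simp add: algebra_simps)

text \<open>Residuals are orthogonal to the kernel, so both sides reduce to
  \<open>?N x \<bullet> ?N y\<close>.\<close>

lemma P_lin_symmetric: "P_lin \<alpha> A x \<bullet> y = x \<bullet> P_lin \<alpha> A y"
proof -
  let ?N = "closest_point (affine_set A 0)"
  have "?N x \<bullet> y = ?N x \<bullet> ?N y"
    using kernel_proj(2)[OF kernel_proj(1), of y x] by (simp add: inner_simps inner_commute)
  moreover have "x \<bullet> ?N y = ?N x \<bullet> ?N y"
    using kernel_proj(2)[OF kernel_proj(1), of x y] by (simp add: inner_simps)
  ultimately show ?thesis
    by (simp add: P_lin_def inner_add_left inner_add_right)
qed

text \<open>\<open>P_lin\<close> acts as the identity on the kernel and as the factor
  \<open>1 - \<alpha>\<close> on its orthogonal complement.\<close>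

lemma P_lin_quadratic_forms:
  fixes h
  defines "n \<equiv> closest_point (affine_set A 0) h"
  shows "P_lin \<alpha> A h \<bullet> h = (norm n)\<^sup>2 + (1 - \<alpha>) * (norm (h - n))\<^sup>2"
    and "(norm (P_lin \<alpha> A h))\<^sup>2 = (norm n)\<^sup>2 + (1 - \<alpha>)\<^sup>2 * (norm (h - n))\<^sup>2"
    and "(norm h)\<^sup>2 = (norm n)\<^sup>2 + (norm (h - n))\<^sup>2"
proof -
  define m where "m = h - n"
  have orth: "m \<bullet> n = 0" "n \<bullet> m = 0"
    using kernel_proj(2)[OF kernel_proj(1), of h h] by (simp_all add: m_def n_def inner_commute)
  have h: "h = n + m"
    by (simp add: m_def)
  have P: "P_lin \<alpha> A h = n + (1 - \<alpha>) *\<^sub>R m"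
    by (simp add: P_lin_def flip: n_def) (simp add: m_def algebra_simps)
  show "P_lin \<alpha> A h \<bullet> h = (norm n)\<^sup>2 + (1 - \<alpha>) * (norm (h - n))\<^sup>2"
    unfolding P m_def[symmetric] by (simp add: h inner_simps orth power2_norm_eq_inner)
  show "(norm (P_lin \<alpha> A h))\<^sup>2 = (norm n)\<^sup>2 + (1 - \<alpha>)\<^sup>2 * (norm (h - n))\<^sup>2"
    unfolding P m_def[symmetric] power2_norm_eq_inner
    by (simp add: inner_simps orth power2_eq_square)
  show "(norm h)\<^sup>2 = (norm n)\<^sup>2 + (norm (h - n))\<^sup>2"
    unfolding m_def[symmetric] power2_norm_eq_inner by (simp add: h inner_simps orth)
qed

section \<open>Two-sided bound for the GAP envelope\<close>

lemma gap_envelope_bregman: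
  fixes C :: "'a set" and b :: 'b and x y :: 'a and \<alpha>1 \<alpha>2 :: real
  assumes C: "closed C" "convex C" "C \<noteq> {}" and ne: "affine_set A b \<noteq> {}" and \<alpha>2: "0 \<le> \<alpha>2"
  defines "F \<equiv> gap_envelope \<alpha>1 \<alpha>2 C A b"
    and "g \<equiv> P_lin \<alpha>1 A (y - relaxed_proj \<alpha>2 C (relaxed_proj \<alpha>1 (affine_set A b) y))"
    and "\<beta>l \<equiv> min ((1 - \<alpha>1) * \<alpha>1) 0"
    and "\<beta>u \<equiv> max ((1 - \<alpha>1) * (1 + (\<alpha>2 - 1) * (1 - \<alpha>1))) \<alpha>2"
  shows "\<beta>l / 2 * (norm (x - y))\<^sup>2 \<le> F x - F y - g \<bullet> (x - y)"
    and "F x - F y - g \<bullet> (x - y) \<le> \<beta>u / 2 * (norm (x - y))\<^sup>2"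
proof -
  define h where "h = x - y"
  define Tx where "Tx = relaxed_proj \<alpha>1 (affine_set A b) x"
  define Ty where "Ty = relaxed_proj \<alpha>1 (affine_set A b) y"
  define D where "D = p_fun \<alpha>2 C Tx - p_fun \<alpha>2 C Ty - relaxed_proj \<alpha>2 C Ty \<bullet> (Tx - Ty)"
  have T: "Tx - Ty = P_lin \<alpha>1 A h"
    unfolding Tx_def Ty_def h_def by (rule relaxed_proj_affine_set_diff[OF ne])
  have "P_lin \<alpha>1 A x \<bullet> x - P_lin \<alpha>1 A y \<bullet> y - 2 * (P_lin \<alpha>1 A y \<bullet> h) = P_lin \<alpha>1 A h \<bullet> h"
    using P_lin_symmetric[of \<alpha>1 x y] unfolding h_def P_lin_diff
    by (simp add: inner_simps inner_commute)
  \<comment> \<open>Chain rule for \<open>p_fun\<close> after the affine map: symmetry moves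
    \<open>P_lin\<close> onto h, giving \<open>Tx - Ty\<close>.\<close>
  moreover have "g \<bullet> h = P_lin \<alpha>1 A y \<bullet> h - relaxed_proj \<alpha>2 C Ty \<bullet> (Tx - Ty)"
    unfolding g_def T Ty_def[symmetric] P_lin_diff
    by (simp add: inner_diff_left P_lin_symmetric[of _ "relaxed_proj _ _ _"])
  ultimately have F: "F x - F y - g \<bullet> h = 1 / 2 * (P_lin \<alpha>1 A h \<bullet> h) - D"
    unfolding F_def gap_envelope_def D_def Tx_def[symmetric] Ty_def[symmetric] by simp
  have D: "(1 - \<alpha>2) / 2 * (norm (P_lin \<alpha>1 A h))\<^sup>2 \<le> D" "D \<le> 1 / 2 * (norm (P_lin \<alpha>1 A h))\<^sup>2"
    using p_fun_bregman[OF C \<alpha>2, where u = Tx and v = Ty] unfolding D_def[symmetric] unfolding T .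
  define n where "n = (norm (closest_point (affine_set A 0) h))\<^sup>2"
  define m where "m = (norm (h - closest_point (affine_set A 0) h))\<^sup>2"
  have nm: "0 \<le> n" "0 \<le> m"
    by (simp_all add: n_def m_def)
  note Q = P_lin_quadratic_forms[where h = h, folded n_def m_def]
  \<comment> \<open>With the upper bound on D, the coefficients of n and m in twice the remaining
    form are 0 and \<open>(1 - \<alpha>1) - (1 - \<alpha>1)^2 = (1 - \<alpha>1) * \<alpha>1\<close>;
    \<beta>l is their minimum.\<close>
  have "\<beta>l * n \<le> 0" "\<beta>l * m \<le> (1 - \<alpha>1) * \<alpha>1 * m"
    using nm by (auto simp: \<beta>l_def mult_nonpos_nonneg intro!: mult_right_mono)
  then have "\<beta>l / 2 * (norm h)\<^sup>2 \<le> F x - F y - g \<bullet> h"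
    using D(2) unfolding F Q by (simp add: field_simps power2_eq_square)
  then show "\<beta>l / 2 * (norm (x - y))\<^sup>2 \<le> F x - F y - g \<bullet> (x - y)"
    unfolding h_def .
  \<comment> \<open>With the lower bound on D they become
    \<open>1 - (1 - \<alpha>2) = \<alpha>2\<close> and
    \<open>(1 - \<alpha>1) - (1 - \<alpha>2) * (1 - \<alpha>1)^2\<close>; \<beta>u is their
    maximum.\<close>
  have "\<alpha>2 * n \<le> \<beta>u * n" "(1 - \<alpha>1) * (1 + (\<alpha>2 - 1) * (1 - \<alpha>1)) * m \<le> \<beta>u * m"
    using nm by (auto simp: \<beta>u_def intro!: mult_right_mono)
  then have "F x - F y - g \<bullet> h \<le> \<beta>u / 2 * (norm h)\<^sup>2"
    using D(1) unfolding F Q by (simp add: field_simps power2_eq_square)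
  then show "F x - F y - g \<bullet> (x - y) \<le> \<beta>u / 2 * (norm (x - y))\<^sup>2"
    unfolding h_def .
qed

end

theorem proposition5p5:
  fixes C :: "'a::euclidean_space set"
    and A :: "'a \<Rightarrow> 'b::euclidean_space" and b :: 'b
    and \<alpha>1 \<alpha>2 :: real
  defines "F \<equiv> gap_envelope \<alpha>1 \<alpha>2 C A b"
    and "\<beta>l \<equiv> min ((1 - \<alpha>1) * \<alpha>1) 0"
    and "\<beta>u \<equiv> max ((1 - \<alpha>1) * (1 + (\<alpha>2 - 1) * (1 - \<alpha>1))) \<alpha>2"
  assumes "C \<noteq> {}" and "closed C" and "convex C"
    and "linear A" and "affine_set A b \<noteq> {}"
    and "\<alpha>1 \<in> {0<..2}" and "\<alpha>2 \<in> {0<..2}"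
  shows "(\<forall>y. F differentiable (at y)) \<and>
         (\<forall>x y. \<beta>l / 2 * (norm (x - y))\<^sup>2 \<le> F x - F y - gradient F y \<bullet> (x - y) \<and>
                F x - F y - gradient F y \<bullet> (x - y) \<le> \<beta>u / 2 * (norm (x - y))\<^sup>2) \<and>
         (\<alpha>1 \<in> {0<..1} \<longrightarrow> convex_on UNIV F)"
proof -
  define g where
    "g y = P_lin \<alpha>1 A (y - relaxed_proj \<alpha>2 C (relaxed_proj \<alpha>1 (affine_set A b) y))" for y
  have "0 \<le> \<alpha>2"
    using assms(10) by simp
  note breg = gap_envelope_bregman[OF assms(7,5,6,4,8) this, of \<alpha>1, folded F_def \<beta>l_def \<beta>u_def g_def]
  have gderiv: "GDERIV F y :> g y" for y
  proof (rule gderiv_of_quadratic_bound)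
    fix x
    \<comment> \<open>One constant must bound the absolute value: \<open>- \<beta>l / 2\<close>
      serves the lower side, \<open>\<beta>u / 2\<close> the upper.\<close>
    have "(- \<beta>l / 2) * (norm (x - y))\<^sup>2 \<le> max (- \<beta>l / 2) (\<beta>u / 2) * (norm (x - y))\<^sup>2"
      "\<beta>u / 2 * (norm (x - y))\<^sup>2 \<le> max (- \<beta>l / 2) (\<beta>u / 2) * (norm (x - y))\<^sup>2"
      by (intro mult_right_mono; simp)+
    then show "\<bar>F x - F y - g y \<bullet> (x - y)\<bar> \<le> max (- \<beta>l / 2) (\<beta>u / 2) * (norm (x - y))\<^sup>2"
      using breg[where x = x and y = y] by (auto simp: abs_le_iff)
  qed
  have "F differentiable (at y)" for y
    using gderiv[of y] unfolding gderiv_def differentiable_def by blast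
  moreover have "convex_on UNIV F" if "\<alpha>1 \<in> {0<..1}"
  proof (rule convex_on_of_subgradients)
    fix x y
    \<comment> \<open>For \<open>\<alpha>1 \<le> 1\<close> the product in the minimum is
      nonnegative, so the lower bound is the subgradient inequality.\<close>
    have "\<beta>l = 0"
      using that by (simp add: \<beta>l_def)
    then show "F y + g y \<bullet> (x - y) \<le> F x"
      using breg(1)[where x = x and y = y] by simp
  qed
  ultimately show ?thesis
    using breg by (auto simp: gradient_eqI[OF gderiv])
qed

end
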